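(* Let $f:[0,\infty)\to(0,\infty)$ be a differentiable mapping and let $a,b\in[0,\infty)$ with $a<b$. Let $(\alpha,m)\in(0,1]\times(0,1]$, $\mu>0$, $q>1$ and $0\le p\le q$. Suppose that $f'\in L[a,b]$, that $|f'|^{q}$ is $(\alpha,m)$-logarithmically convex, and that $|f'(x)|^{q}\le M$. Then for every $x\in[a,b]$, $$\left|\frac{(x-a)^{\mu}+(b-x)^{\mu}}{b-a}f(x)-\frac{\Gamma(\mu+1)}{b-a}\left[J_{x^-}^{\mu}f(a)+J_{x^+}^{\mu}f(b)\right]\right|\le\left(\frac{q-1}{\mu(q-p)+q-1}\right)^{\frac{q-1}{q}}K_2^{\frac1q}\left[\frac{(x-a)^{\mu+1}+(b-x)^{\mu+1}}{b-a}\right],$$ where $$K_2=\begin{cases}\dfrac{M^{m}\left(\Gamma(\mu p+1)-\Gamma\left(\mu p+1,\ln M^{\alpha(m-1)}\right)\right)}{\left(\ln M^{\alpha(m-1)}\right)^{\mu p+1}}, & M<1,\\[2mm] \dfrac{1}{\mu p+1}, & M=1.\end{cases}$$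
   Context: For $(\alpha,m)\in(0,1]\times(0,1]$, a function $g:[0,\infty)\to(0,\infty)$ is $(\alpha,m)$-logarithmically convex if $g(tx+m(1-t)y)\le [g(x)]^{t^{\alpha}}[g(y)]^{m(1-t^{\alpha})}$ for all $x,y\in[0,\infty)$ and $t\in[0,1]$. $M$ is a constant, and the bound $|f'(x)|^q\le M$ is meant for all $x\in[0,\infty)$. Riemann-Liouville fractional integrals of order $\mu>0$: $J_{x^-}^{\mu}f(a)=\frac{1}{\Gamma(\mu)}\int_a^x (t-a)^{\mu-1}f(t)\,dt$ and $J_{x^+}^{\mu}f(b)=\frac{1}{\Gamma(\mu)}\int_x^b (b-t)^{\mu-1}f(t)\,dt$, where $\Gamma(s)$ is the Gamma function. $\Gamma(s,z)=\int_z^\infty e^{-u}u^{s-1}\,du$ is the upper incomplete Gamma function. $L[a,b]$ denotes the Lebesgue integrable functions on $[a,b]$.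
   Formalization: For M<1 and m=1 the displayed formula for K_2 is 0/0, so there K_2 is taken to be its limit M/(μp+1); M≤1 is assumed, since K_2 is given only for M<1 and M=1. *)

theory Defs
  imports "HOL-Analysis.Analysis"
begin

definition log_convex_am :: "real \<Rightarrow> real \<Rightarrow> (real \<Rightarrow> real) \<Rightarrow> bool" where
  "log_convex_am \<alpha> m g \<longleftrightarrow>
     (\<forall>x\<ge>0. 0 < g x) \<and>
     (\<forall>x\<ge>0. \<forall>y\<ge>0. \<forall>t\<in>{0..1}.
        g (t * x + m * (1 - t) * y) \<le> g x powr (t powr \<alpha>) * g y powr (m * (1 - t powr \<alpha>)))"

text \<open>\<open>RL_minus \<mu> f x a\<close> is $J_{x^-}^{\mu} f(a)$ (for $a \le x$) and \<open>RL_plus \<mu> f x b\<close> is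
  $J_{x^+}^{\mu} f(b)$ (for $x \le b$): the first real argument is the subscript, the second one
  the point of evaluation.\<close>

definition RL_minus :: "real \<Rightarrow> (real \<Rightarrow> real) \<Rightarrow> real \<Rightarrow> real \<Rightarrow> real" where
  "RL_minus \<mu> f x a =
     1 / Gamma \<mu> * set_lebesgue_integral lebesgue {a..x} (\<lambda>t. (t - a) powr (\<mu> - 1) * f t)"

definition RL_plus :: "real \<Rightarrow> (real \<Rightarrow> real) \<Rightarrow> real \<Rightarrow> real \<Rightarrow> real" where
  "RL_plus \<mu> f x b =
     1 / Gamma \<mu> * set_lebesgue_integral lebesgue {x..b} (\<lambda>t. (b - t) powr (\<mu> - 1) * f t)"

definition upper_Gamma :: "real \<Rightarrow> real \<Rightarrow> real" where
  "upper_Gamma s z = set_lebesgue_integral lebesgue {z..} (\<lambda>u. exp (- u) * u powr (s - 1))"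

text \<open>The constant is only meaningful for $0 < M \le 1$. For $M < 1$ and $m = 1$ the incomplete
  Gamma expression has the form $0/0$; there we take its limit as $m$ tends to $1$ from below,
  namely $M^m / (\mu p + 1)$ with $m = 1$.\<close>

definition K2 :: "real \<Rightarrow> real \<Rightarrow> real \<Rightarrow> real \<Rightarrow> real \<Rightarrow> real" where
  "K2 \<alpha> m \<mu> p M =
     (if M = 1 then 1 / (\<mu> * p + 1)
      else if m = 1 then M powr m / (\<mu> * p + 1)
      else M powr m *
             (Gamma (\<mu> * p + 1) - upper_Gamma (\<mu> * p + 1) (ln (M powr (\<alpha> * (m - 1))))) /
             ln (M powr (\<alpha> * (m - 1))) powr (\<mu> * p + 1))"

end

theory Submission
  imports Defs
begin

text \<open>On the segment from an endpoint e to x put h(t) = f(e + t(x - e)). Integrating the derivative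
  of t^\<mu> h(t) over [0,1] gives h(1) - \<mu> \<integral> t^(\<mu>-1) h(t) dt = \<integral> t^\<mu> h'(t) dt, and the left-hand side
  is one of the two halves of the claimed expression, up to scaling. Writing e = m (e/m),
  logarithmic convexity bounds |f'|^q at e + t(x - e) by M^(m + (1-m) t^\<alpha>), and since M \<le> 1 and
  \<alpha> t \<le> t^\<alpha> this is at most M^m exp(-c t) with c = ln M^(\<alpha>(m-1)). The integral of t^(\<mu>p)
  against this weight is a lower incomplete Gamma function, namely K2, so Hoelder's inequality
  finishes the proof.\<close>

section \<open>Exponential weights on the unit interval, incomplete Gamma functions and
  \<open>K2\<close>\<close>

text \<open>Split the Gamma integral at \<open>c\<close>; the two pieces overlap only in a single
  point. The integrand is nonnegative, hence absolutely integrable, and this identifies the Lebesgue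
  integral in \<open>upper_Gamma\<close> with the gauge integral over the tail.\<close>

lemma has_integral_lower_Gamma:
  fixes s c :: real
  assumes "0 < s" and "0 \<le> c"
  shows "((\<lambda>u. u powr (s - 1) * exp (- u)) has_integral Gamma s - upper_Gamma s c) {0..c}"
proof -
  let ?f = "\<lambda>u::real. u powr (s - 1) * exp (- u)"
  have full: "(?f has_integral Gamma s) {0..}"
    using Gamma_integral_real[OF \<open>0 < s\<close>] by (simp add: exp_minus field_simps)
  then have "?f absolutely_integrable_on {0..}"
    by (intro nonnegative_absolutely_integrable_1) (auto simp: integrable_on_def)
  then have tail: "?f absolutely_integrable_on {c..}"
    by (rule set_integrable_subset) (use \<open>0 \<le> c\<close> in auto)
  then have "upper_Gamma s c = integral {c..} ?f"
    unfolding upper_Gamma_def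
    by (subst set_lebesgue_integral_eq_integral(2)[symmetric]) (auto simp: mult.commute)
  with tail have upper: "(?f has_integral upper_Gamma s c) {c..}"
    using set_lebesgue_integral_eq_integral(1) by fastforce
  have "?f absolutely_integrable_on {0..c}"
    by (rule set_integrable_subset[OF \<open>?f absolutely_integrable_on {0..}\<close>]) auto
  then obtain i where lower: "(?f has_integral i) {0..c}"
    using set_lebesgue_integral_eq_integral(1) by blast
  have "{0..c} \<inter> {c..} = {c}" "{0..c} \<union> {c..} = {0..}"
    using \<open>0 \<le> c\<close> by auto
  then have "(?f has_integral i + upper_Gamma s c) {0..}"
    using has_integral_Un[OF lower upper] by simp
  then have "i = Gamma s - upper_Gamma s c"
    using has_integral_unique[OF full] by force
  with lower show ?thesis by simp
qed

text \<open>Substitute u = c t. The factor \<open>c powr (1 - s)\<close> strips \<open>c\<close>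
  from the power of \<open>c * t\<close> and turns the Jacobian 1/c into
  \<open>1 / c powr s\<close>.\<close>

lemma has_integral_lower_Gamma_unit_interval:
  fixes s c :: real
  assumes "0 < s" and "0 < c"
  shows "((\<lambda>t. t powr (s - 1) * exp (- (c * t))) has_integral
           (Gamma s - upper_Gamma s c) / c powr s) {0..1}"
proof -
  have "((\<lambda>t. (c * t) powr (s - 1) * exp (- (c * t))) has_integral
          (Gamma s - upper_Gamma s c) / c) {0..1}"
    using has_integral_affinity[of _ _ 0 c c 0, unfolded cbox_interval, OF has_integral_lower_Gamma] assms
      image_affinity_atLeastAtMost_div[of c 0 0 c]
    by simp
  then have "((\<lambda>t. c powr (1 - s) * ((c * t) powr (s - 1) * exp (- (c * t)))) has_integral
          c powr (1 - s) * ((Gamma s - upper_Gamma s c) / c)) {0..1}"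
    by (rule has_integral_mult_right)
  moreover have "c powr (1 - s) * ((c * t) powr (s - 1) * exp (- (c * t)))
      = t powr (s - 1) * exp (- (c * t))" if "t \<in> {0..1}" for t
  proof -
    have "c powr (1 - s) * c powr (s - 1) = 1"
      using \<open>0 < c\<close> by (simp flip: powr_add)
    then show ?thesis
      using that \<open>0 < c\<close> by (simp add: powr_mult)
  qed
  moreover have "c powr (1 - s) * ((Gamma s - upper_Gamma s c) / c)
      = (Gamma s - upper_Gamma s c) / c powr s"
    using \<open>0 < c\<close> by (simp add: powr_diff)
  ultimately show ?thesis
    by (metis (no_types, lifting) has_integral_cong)
qed

text \<open>All branches of \<open>K2\<close> are values of one integral. If \<open>M = 1\<close> or
  \<open>m = 1\<close>, the exponential rate vanishes and the weight is the constant
  \<open>M powr m\<close>; otherwise the rate is positive and the incomplete Gamma formula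
  applies.\<close>

lemma has_integral_K2:
  fixes \<alpha> m \<mu> p M :: real
  assumes "0 < \<alpha>" "m \<le> 1" "0 < \<mu>" "0 \<le> p" "0 < M" "M \<le> 1"
  shows "((\<lambda>t. t powr (\<mu> * p) * (M powr m * exp (- (\<alpha> * (m - 1) * ln M * t))))
           has_integral K2 \<alpha> m \<mu> p M) {0..1}"
proof (cases "M = 1 \<or> m = 1")
  case True
  have "((\<lambda>t. t powr (\<mu> * p) * M powr m) has_integral
          (1 powr (\<mu> * p + 1) / (\<mu> * p + 1)) * M powr m) {0..1}"
    by (intro has_integral_mult_left has_integral_powr_from_0)
      (use assms in \<open>auto intro: less_le_trans[of _ 0]\<close>)
  with True show ?thesis
    by (auto simp: K2_def)
next
  case False
  define c where "c = \<alpha> * (m - 1) * ln M"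
  \<comment> \<open>Here \<open>m < 1\<close> and \<open>M < 1\<close>, so \<open>m - 1\<close> and
    \<open>ln M\<close> are both negative.\<close>
  have "0 < \<alpha> * ((m - 1) * ln M)"
    using False assms by (intro mult_pos_pos mult_neg_neg) auto
  then have "0 < c" by (simp add: c_def mult.assoc)
  have c: "ln (M powr (\<alpha> * (m - 1))) = c"
    using \<open>0 < M\<close> by (simp add: c_def ln_powr)
  have "0 < \<mu> * p + 1" using assms by (simp add: add_nonneg_pos)
  from has_integral_mult_right[OF has_integral_lower_Gamma_unit_interval[OF this \<open>0 < c\<close>],
      of "M powr m"]
  show ?thesis
    using False unfolding K2_def c by (simp add: c_def[symmetric] mult.left_commute)
qed

text \<open>On the unit interval the weight is at least its value at t = 1, so the integral is
  bounded below by that of a positive multiple of a power. Positivity permits the normalization in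
  Hoelder's inequality.\<close>

lemma K2_pos:
  fixes \<alpha> m \<mu> p M :: real
  assumes "0 < \<alpha>" "m \<le> 1" "0 < \<mu>" "0 \<le> p" "0 < M" "M \<le> 1"
  shows "0 < K2 \<alpha> m \<mu> p M"
proof -
  define c where "c = \<alpha> * (m - 1) * ln M"
  have "0 \<le> \<alpha> * ((m - 1) * ln M)"
    using assms by (intro mult_nonneg_nonneg mult_nonpos_nonpos) auto
  then have "0 \<le> c" by (simp add: c_def mult.assoc)
  have "0 \<le> \<mu> * p" using assms by simp
  have "((\<lambda>t. t powr (\<mu> * p) * (M powr m * exp (- c))) has_integral
          (1 powr (\<mu> * p + 1) / (\<mu> * p + 1)) * (M powr m * exp (- c))) {0..1}"
    using \<open>0 \<le> \<mu> * p\<close> by (intro has_integral_mult_left has_integral_powr_from_0) auto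
  moreover have "t powr (\<mu> * p) * (M powr m * exp (- c)) \<le> t powr (\<mu> * p) * (M powr m * exp (- (c * t)))"
    if "t \<in> {0..1}" for t
    using that \<open>0 \<le> c\<close> by (intro mult_left_mono) (auto intro: mult_left_le)
  ultimately have "1 / (\<mu> * p + 1) * (M powr m * exp (- c)) \<le> K2 \<alpha> m \<mu> p M"
    using has_integral_le[OF _ has_integral_K2[OF assms, folded c_def]] by simp
  moreover have "0 < 1 / (\<mu> * p + 1) * (M powr m * exp (- c))"
    using \<open>0 \<le> \<mu> * p\<close> \<open>0 < M\<close> by simp
  ultimately show ?thesis by linarith
qed

section \<open>Hoelder's inequality and the pointwise convexity bound\<close>

text \<open>Apply Young's inequality pointwise to \<open>u\<close> and \<open>v\<close> divided by
  their norms; the right-hand side then integrates to 1/r + 1/q = 1.\<close>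

lemma has_integral_Holder:
  fixes u v :: "'a::euclidean_space \<Rightarrow> real"
  assumes "1 < r" "1 < q" "1 / r + 1 / q = 1"
    and "\<And>t. t \<in> S \<Longrightarrow> 0 \<le> u t" "\<And>t. t \<in> S \<Longrightarrow> 0 \<le> v t"
    and A: "((\<lambda>t. u t powr r) has_integral A) S" "0 < A"
    and B: "((\<lambda>t. v t powr q) has_integral B) S" "0 < B"
    and C: "((\<lambda>t. u t * v t) has_integral C) S"
  shows "C \<le> A powr (1 / r) * B powr (1 / q)"
proof -
  define k where "k = A powr (1 / r) * B powr (1 / q)"
  have "0 < k" using A B by (simp add: k_def)
  have "((\<lambda>t. u t powr r / A / r + v t powr q / B / q) has_integral A / A / r + B / B / q) S"
    by (intro has_integral_add has_integral_divide A B)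
  then have "((\<lambda>t. u t powr r / A / r + v t powr q / B / q) has_integral 1) S"
    using assms by simp
  moreover have "((\<lambda>t. u t * v t / k) has_integral C / k) S"
    by (intro has_integral_divide C)
  moreover have "u t * v t / k \<le> u t powr r / A / r + v t powr q / B / q" if "t \<in> S" for t
    using Youngs_inequality[of r q "u t / A powr (1 / r)" "v t / B powr (1 / q)"] assms that
    by (simp add: k_def powr_divide powr_powr)
  ultimately have "C / k \<le> 1"
    using has_integral_le by blast
  with \<open>0 < k\<close> show ?thesis
    by (simp add: k_def[symmetric])
qed

lemma log_convex_am_bound:
  fixes g :: "real \<Rightarrow> real"
  assumes g: "log_convex_am \<alpha> m g" and M: "\<And>y. 0 \<le> y \<Longrightarrow> g y \<le> M" "0 < M" "M \<le> 1"
    and "0 < \<alpha>" "\<alpha> \<le> 1" "0 < m" "m \<le> 1" and "0 \<le> x" "0 \<le> e" and t: "t \<in> {0..1}"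
  shows "g (e + t * (x - e)) \<le> M powr m * exp (- (\<alpha> * (m - 1) * ln M * t))"
proof -
  have pos: "0 < g y" if "0 \<le> y" for y
    using g that by (auto simp: log_convex_am_def)
  have "t powr \<alpha> \<le> 1" using t \<open>0 < \<alpha>\<close> by (simp add: powr_le1)
  have "t = t powr 1" using t by simp
  also have "t powr 1 \<le> t powr \<alpha>"
    using t \<open>\<alpha> \<le> 1\<close> by (cases "t = 0") (use powr_mono'[of \<alpha> 1 t] in auto)
  finally have "t \<le> t powr \<alpha>" .
  moreover have "\<alpha> * t \<le> t"
    using t \<open>\<alpha> \<le> 1\<close> by (simp add: mult_left_le_one_le \<open>0 < \<alpha>\<close> less_imp_le)
  ultimately have "\<alpha> * t \<le> t powr \<alpha>" by linarith
  then have le: "m + (1 - m) * (\<alpha> * t) \<le> m + (1 - m) * t powr \<alpha>"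
    using \<open>m \<le> 1\<close> by (intro add_left_mono mult_left_mono) auto
  \<comment> \<open>Taking \<open>e / m\<close> as second point cancels the factor \<open>m\<close>,
    leaving the ordinary convex combination of \<open>x\<close> and \<open>e\<close>. As
    \<open>e / m\<close> can lie beyond the segment, the bound \<open>M\<close> is used on the whole
    half-line.\<close>
  have "g (t * x + m * (1 - t) * (e / m)) \<le> g x powr (t powr \<alpha>) * g (e / m) powr (m * (1 - t powr \<alpha>))"
    using g[unfolded log_convex_am_def, THEN conjunct2, rule_format, of x "e / m" t]
      t \<open>0 \<le> x\<close> \<open>0 \<le> e\<close> \<open>0 < m\<close> by simp
  moreover have "t * x + m * (1 - t) * (e / m) = e + t * (x - e)"
    using \<open>0 < m\<close> by (simp add: field_simps)
  ultimately have "g (e + t * (x - e)) \<le> g x powr (t powr \<alpha>) * g (e / m) powr (m * (1 - t powr \<alpha>))"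
    by simp
  also have "\<dots> \<le> M powr (t powr \<alpha>) * M powr (m * (1 - t powr \<alpha>))"
    using M(1) pos \<open>0 \<le> x\<close> \<open>0 \<le> e\<close> \<open>0 < m\<close> \<open>t powr \<alpha> \<le> 1\<close>
    by (intro mult_mono powr_mono2 mult_nonneg_nonneg) (auto intro: less_imp_le)
  also have "\<dots> = M powr (m + (1 - m) * t powr \<alpha>)"
    by (simp add: algebra_simps flip: powr_add)
  \<comment> \<open>Powers of \<open>M \<le> 1\<close> decrease in the exponent, so a smaller
    exponent gives an upper bound. It is now affine in \<open>t\<close>, and the slope with
    \<open>\<alpha> * t\<close> rather than \<open>t\<close> matches the constant in
    \<open>K2\<close>.\<close>
  also have "\<dots> \<le> M powr (m + (1 - m) * (\<alpha> * t))"
    using le M by (intro powr_mono') auto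
  also have "\<dots> = M powr m * exp (- (\<alpha> * (m - 1) * ln M * t))"
    using M by (simp add: powr_add) (simp add: powr_def algebra_simps)
  finally show ?thesis .
qed

section \<open>The estimate along a segment from an endpoint to \<open>x\<close>\<close>

text \<open>Integration by parts: the boundary term of t^\<mu> h(t) at 0 vanishes, so
  \<open>h 1 - \<mu> * I\<close> is the integral of t^\<mu> h'(t), which \<open>C\<close>
  dominates.\<close>

lemma weighted_derivative_bound:
  fixes h h' G :: "real \<Rightarrow> real"
  assumes "0 < \<mu>"
    and h: "\<And>t. t \<in> {0..1} \<Longrightarrow> (h has_real_derivative h' t) (at t within {0..1})"
    and G: "\<And>t. t \<in> {0..1} \<Longrightarrow> \<bar>h' t\<bar> \<le> G t"
    and C: "((\<lambda>t. t powr \<mu> * G t) has_integral C) {0..1}"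
  obtains I where "((\<lambda>t. t powr (\<mu> - 1) * h t) has_integral I) {0..1}" and "\<bar>h 1 - \<mu> * I\<bar> \<le> C"
proof -
  have cont: "continuous_on {0..1} h"
    using h by (rule DERIV_continuous_on)
  \<comment> \<open>For \<open>\<mu> < 1\<close> this weight is unbounded near 0, so the product
    with \<open>h\<close> is handled as an absolutely integrable function times a bounded measurable
    one.\<close>
  have "(\<lambda>t. t powr (\<mu> - 1)) absolutely_integrable_on {0..1::real}"
    using has_integral_powr_from_0[of "\<mu> - 1" 1] \<open>0 < \<mu>\<close>
    by (intro nonnegative_absolutely_integrable_1) (auto simp: integrable_on_def)
  then have "(\<lambda>t. h t * t powr (\<mu> - 1)) absolutely_integrable_on {0..1}"
    using cont
    by (intro absolutely_integrable_bounded_measurable_product_real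
        continuous_imp_measurable_on_sets_lebesgue compact_imp_bounded compact_continuous_image
        compact_Icc) auto
  then have "(\<lambda>t. h t * t powr (\<mu> - 1)) integrable_on {0..1}"
    by (rule set_lebesgue_integral_eq_integral(1))
  then obtain I where I: "((\<lambda>t. t powr (\<mu> - 1) * h t) has_integral I) {0..1}"
    unfolding integrable_on_def by (auto simp: mult.commute)
  \<comment> \<open>For \<open>\<mu> < 1\<close> the power t^\<mu> has no finite derivative at 0;
    continuity up to the endpoints and differentiability in the interior suffice.\<close>
  have "((\<lambda>t. \<mu> * (t powr (\<mu> - 1) * h t) + t powr \<mu> * h' t) has_integral
          1 powr \<mu> * h 1 - 0 powr \<mu> * h 0) {0..1}"
  proof (rule fundamental_theorem_of_calculus_interior)
    show "continuous_on {0..1} (\<lambda>t. t powr \<mu> * h t)"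
      using \<open>0 < \<mu>\<close> cont by (intro continuous_on_mult continuous_on_powr') auto
  next
    fix t :: real
    assume t: "t \<in> {0<..<1}"
    then have h_t: "(h has_real_derivative h' t) (at t)"
      using h[of t] at_within_interior[of t "{0..1}"] by simp
    have "((\<lambda>t. t powr \<mu>) has_real_derivative \<mu> * t powr (\<mu> - 1)) (at t)"
      using t by (intro has_real_derivative_powr) auto
    from DERIV_mult[OF this h_t]
    have "((\<lambda>t. t powr \<mu> * h t) has_real_derivative
        \<mu> * (t powr (\<mu> - 1) * h t) + t powr \<mu> * h' t) (at t)"
      by (rule DERIV_cong) (simp add: algebra_simps)
    then show "((\<lambda>t. t powr \<mu> * h t) has_vector_derivative
        \<mu> * (t powr (\<mu> - 1) * h t) + t powr \<mu> * h' t) (at t)"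
      by (simp add: has_real_derivative_iff_has_vector_derivative)
  qed simp
  \<comment> \<open>The subtraction also yields the integrability of t^\<mu> h'(t).\<close>
  from has_integral_diff[OF this has_integral_mult_right[OF I, of \<mu>]]
  have "((\<lambda>t. t powr \<mu> * h' t) has_integral h 1 - \<mu> * I) {0..1}"
    using \<open>0 < \<mu>\<close> by simp
  from has_integral_norm_bound_integral_component[OF this C, of 1] G
  have "\<bar>h 1 - \<mu> * I\<bar> \<le> C"
    by (simp add: abs_mult mult_left_mono)
  with I show ?thesis by (rule that)
qed

text \<open>Substitute y = e + t(x - e): the kernel contributes |x - e|^(\<mu>-1) and the Jacobian
  |x - e|. Absolute values and \<open>closed_segment\<close> cover both orders of \<open>e\<close>
  and \<open>x\<close>; nonnegativity of \<open>f\<close> turns the gauge integral into a Lebesgue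
  integral.\<close>

lemma set_lebesgue_integral_segment:
  fixes f :: "real \<Rightarrow> real"
  assumes "e \<noteq> x" and "\<And>y. y \<in> closed_segment e x \<Longrightarrow> 0 \<le> f y"
    and I: "((\<lambda>t. t powr (\<mu> - 1) * f (e + t * (x - e))) has_integral I) {0..1}"
  shows "set_lebesgue_integral lebesgue (closed_segment e x) (\<lambda>y. \<bar>y - e\<bar> powr (\<mu> - 1) * f y)
           = \<bar>x - e\<bar> powr \<mu> * I"
proof -
  define d where "d = x - e"
  have "d \<noteq> 0" and x: "x = e + d" using \<open>e \<noteq> x\<close> by (auto simp: d_def)
  let ?g = "\<lambda>y. \<bar>d\<bar> powr (\<mu> - 1) * (((y - e) / d) powr (\<mu> - 1) * f y)"
  \<comment> \<open>This is the map t to e + d t, spelled in the form in which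
    \<open>has_integral_affinity\<close> presents the image.\<close>
  have "(\<lambda>t. (1 / (1 / d)) * t + - ((1 / (1 / d)) * (- (e / d)))) ` {0..1} = closed_segment e x"
    using \<open>d \<noteq> 0\<close> by (auto simp: x closed_segment_eq_real_ivl image_affinity_atLeastAtMost)
  with has_integral_affinity[OF I[unfolded cbox_interval[symmetric]], of "1 / d" "- (e / d)"]
  have "((\<lambda>y. ((y - e) / d) powr (\<mu> - 1) * f (e + (y - e) / d * d)) has_integral \<bar>d\<bar> * I)
      (closed_segment e x)"
    using \<open>d \<noteq> 0\<close> by (simp add: x diff_divide_distrib)
  then have "(?g has_integral \<bar>d\<bar> powr (\<mu> - 1) * (\<bar>d\<bar> * I)) (closed_segment e x)"
    using \<open>d \<noteq> 0\<close> by (intro has_integral_mult_right) simp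
  moreover have "\<bar>d\<bar> powr (\<mu> - 1) * (\<bar>d\<bar> * I) = \<bar>x - e\<bar> powr \<mu> * I"
    using \<open>d \<noteq> 0\<close> by (simp add: d_def powr_diff)
  moreover have "?g y = \<bar>y - e\<bar> powr (\<mu> - 1) * f y" if "y \<in> closed_segment e x" for y
  proof -
    \<comment> \<open>Numerator and denominator share their sign whichever way the segment points,
      so the absolute value factors through \<open>\<bar>d\<bar>\<close>.\<close>
    have "0 \<le> (y - e) / d"
      using that by (auto simp: x closed_segment_eq_real_ivl divide_simps split: if_splits)
    then have "\<bar>y - e\<bar> = \<bar>d\<bar> * ((y - e) / d)"
      using \<open>d \<noteq> 0\<close> by (metis abs_mult abs_of_nonneg nonzero_mult_div_cancel_left times_divide_eq_right)
    then have "\<bar>y - e\<bar> powr (\<mu> - 1) = \<bar>d\<bar> powr (\<mu> - 1) * ((y - e) / d) powr (\<mu> - 1)"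
      using \<open>0 \<le> (y - e) / d\<close> by (metis abs_ge_zero powr_mult)
    then show ?thesis
      by simp
  qed
  ultimately have *: "((\<lambda>y. \<bar>y - e\<bar> powr (\<mu> - 1) * f y) has_integral \<bar>x - e\<bar> powr \<mu> * I)
      (closed_segment e x)"
    using has_integral_eq[where f = ?g] by simp
  then have "(\<lambda>y. \<bar>y - e\<bar> powr (\<mu> - 1) * f y) absolutely_integrable_on closed_segment e x"
    using assms(2) by (intro nonnegative_absolutely_integrable_1) (auto simp: integrable_on_def)
  then show ?thesis
    using * by (simp add: set_lebesgue_integral_eq_integral(2) integral_unique)
qed

text \<open>Taking \<open>e = a\<close> and \<open>e = b\<close> gives the two halves of the
  theorem. The kernel scales by |x - e|^\<mu> and the chain rule adds one factor |x - e|, whence the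
  exponent \<open>\<mu> + 1\<close>.\<close>

lemma fractional_segment_bound:
  fixes f f' :: "real \<Rightarrow> real" and e x \<alpha> m \<mu> p q M :: real
  assumes f_nonneg: "\<And>y. 0 \<le> y \<Longrightarrow> 0 \<le> f y"
    and f': "\<And>y. 0 \<le> y \<Longrightarrow> (f has_real_derivative f' y) (at y within {0..})"
    and "0 \<le> e" "0 \<le> x"
    and "0 < \<alpha>" "\<alpha> \<le> 1" "0 < m" "m \<le> 1" "0 < \<mu>" "1 < q" "0 \<le> p" "p \<le> q"
    and lc: "log_convex_am \<alpha> m (\<lambda>y. \<bar>f' y\<bar> powr q)"
    and M: "\<And>y. 0 \<le> y \<Longrightarrow> \<bar>f' y\<bar> powr q \<le> M" "M \<le> 1"
  shows "\<bar>\<bar>x - e\<bar> powr \<mu> * f x - \<mu> * set_lebesgue_integral lebesgue (closed_segment e x)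
             (\<lambda>y. \<bar>y - e\<bar> powr (\<mu> - 1) * f y)\<bar>
         \<le> ((q - 1) / (\<mu> * (q - p) + q - 1)) powr ((q - 1) / q)
             * K2 \<alpha> m \<mu> p M powr (1 / q) * \<bar>x - e\<bar> powr (\<mu> + 1)"
proof (cases "e = x")
  case True
  \<comment> \<open>The segment is a point, and both sides vanish because \<open>0 powr z\<close> is
    0 for every exponent.\<close>
  have "(\<lambda>y. indicator {x} y *\<^sub>R (\<bar>y - x\<bar> powr (\<mu> - 1) * f y)) = (\<lambda>_. 0)"
    by (auto simp: indicator_def)
  with True show ?thesis unfolding set_lebesgue_integral_def by simp
next
  case False
  \<comment> \<open>Logarithmic convexity includes strict positivity, here used at the point
    0.\<close>
  have "0 < M"
    using lc M(1)[of 0] unfolding log_convex_am_def by (meson less_le_trans order_refl)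
  define c where "c = \<alpha> * (m - 1) * ln M"
  define W where "W t = M powr m * exp (- (c * t))" for t
  have "0 < W t" for t using \<open>0 < M\<close> by (simp add: W_def)
  \<comment> \<open>\<open>W\<close> will bound |f'|^q along the segment, so \<open>G\<close> bounds
    |f'| itself.\<close>
  define G where "G t = W t powr (1 / q)" for t
  have contG: "continuous_on {0..1} G"
    unfolding G_def W_def using \<open>0 < M\<close> by (intro continuous_intros) auto
  have "continuous_on {0..1} (\<lambda>t. t powr \<mu> * G t)"
    using \<open>0 < \<mu>\<close> contG by (intro continuous_on_mult continuous_on_powr') auto
  then obtain C where C: "((\<lambda>t. t powr \<mu> * G t) has_integral C) {0..1}"
    using integrable_continuous_interval by blast
  define r where "r = q / (q - 1)"
  have "1 < r" "1 / r + 1 / q = 1"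
    using \<open>1 < q\<close> by (auto simp: r_def field_simps)
  have "0 \<le> \<mu> * (q - p) / (q - 1)" using assms by simp
  have den: "0 < \<mu> * (q - p) + q - 1" using assms by (smt (verit) mult_nonneg_nonneg)
  \<comment> \<open>Splitting t^\<mu> = t^(\<mu>(q-p)/q) t^(\<mu>p/q) is what brings the parameter p into the bound.\<close>
  have "C \<le> ((q - 1) / (\<mu> * (q - p) + q - 1)) powr (1 / r) * K2 \<alpha> m \<mu> p M powr (1 / q)"
  proof (rule has_integral_Holder[where S = "{0..1}" and u = "\<lambda>t. t powr (\<mu> * (q - p) / q)"
        and v = "\<lambda>t. t powr (\<mu> * p / q) * G t"])
    \<comment> \<open>Raising the first factor to the conjugate exponent \<open>r\<close> gives this
      power, whose integral is the base of the first constant.\<close>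
    have "((\<lambda>t. t powr (\<mu> * (q - p) / (q - 1))) has_integral
        1 powr (\<mu> * (q - p) / (q - 1) + 1) / (\<mu> * (q - p) / (q - 1) + 1)) {0..1}"
      using \<open>0 \<le> \<mu> * (q - p) / (q - 1)\<close> by (intro has_integral_powr_from_0) auto
    moreover have "1 powr (\<mu> * (q - p) / (q - 1) + 1) / (\<mu> * (q - p) / (q - 1) + 1)
        = (q - 1) / (\<mu> * (q - p) + q - 1)"
      using \<open>1 < q\<close> den by (simp add: field_simps)
    moreover have "\<mu> * (q - p) / q * r = \<mu> * (q - p) / (q - 1)"
      using \<open>1 < q\<close> by (simp add: r_def)
    ultimately show "((\<lambda>t. (t powr (\<mu> * (q - p) / q)) powr r) has_integral
        (q - 1) / (\<mu> * (q - p) + q - 1)) {0..1}"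
      by (simp add: powr_powr)
    show "0 < (q - 1) / (\<mu> * (q - p) + q - 1)" using den \<open>1 < q\<close> by simp
    have "(t powr (\<mu> * p / q) * G t) powr q = t powr (\<mu> * p) * W t" for t
      using \<open>1 < q\<close> \<open>0 < W t\<close> by (simp add: G_def powr_mult powr_powr)
    then show "((\<lambda>t. (t powr (\<mu> * p / q) * G t) powr q) has_integral K2 \<alpha> m \<mu> p M) {0..1}"
      using has_integral_K2 assms \<open>0 < M\<close> by (simp add: W_def c_def)
    show "0 < K2 \<alpha> m \<mu> p M" using K2_pos assms \<open>0 < M\<close> by blast
    have "\<mu> * (q - p) / q + \<mu> * p / q = \<mu>" using \<open>1 < q\<close> by (simp add: field_simps)
    then have "t powr (\<mu> * (q - p) / q) * (t powr (\<mu> * p / q) * G t) = t powr \<mu> * G t" for t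
      by (metis mult.assoc powr_add)
    with C show "((\<lambda>t. t powr (\<mu> * (q - p) / q) * (t powr (\<mu> * p / q) * G t)) has_integral C) {0..1}"
      by presburger
  qed (use \<open>1 < r\<close> \<open>1 < q\<close> \<open>1 / r + 1 / q = 1\<close> in \<open>auto simp: G_def\<close>)
  then have C_le: "C \<le> ((q - 1) / (\<mu> * (q - p) + q - 1)) powr ((q - 1) / q) * K2 \<alpha> m \<mu> p M powr (1 / q)"
    by (simp add: r_def)
  have seg: "0 \<le> e + t * (x - e)" if "t \<in> {0..1}" for t
  proof -
    have "0 \<le> (1 - t) * e + t * x" using that \<open>0 \<le> e\<close> \<open>0 \<le> x\<close> by simp
    then show ?thesis by (simp add: algebra_simps)
  qed
  have h: "((\<lambda>t. f (e + t * (x - e))) has_real_derivative (x - e) * f' (e + t * (x - e)))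
      (at t within {0..1})" if "t \<in> {0..1}" for t
  proof -
    \<comment> \<open>The derivative is taken within the image of the segment, which lies in the
      half-line; this covers the one-sided derivative at 0.\<close>
    have "(f has_real_derivative f' (e + t * (x - e)))
        (at (e + t * (x - e)) within (\<lambda>t. e + t * (x - e)) ` {0..1})"
      by (rule DERIV_subset[OF f'[OF seg[OF that]]]) (use seg in auto)
    moreover have "((\<lambda>t. e + t * (x - e)) has_real_derivative (x - e)) (at t within {0..1})"
      by (auto intro!: derivative_eq_intros)
    ultimately have "(f \<circ> (\<lambda>t. e + t * (x - e)) has_real_derivative f' (e + t * (x - e)) * (x - e))
        (at t within {0..1})"
      by (rule DERIV_image_chain)
    then show ?thesis by (simp add: o_def mult.commute)
  qed
  have bound: "\<bar>(x - e) * f' (e + t * (x - e))\<bar> \<le> \<bar>x - e\<bar> * G t" if "t \<in> {0..1}" for t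
  proof -
    have "\<bar>f' (e + t * (x - e))\<bar> powr q \<le> W t"
      unfolding W_def c_def
      by (rule log_convex_am_bound[OF lc]) (use assms \<open>0 < M\<close> that in auto)
    then have "(\<bar>f' (e + t * (x - e))\<bar> powr q) powr (1 / q) \<le> G t"
      unfolding G_def using \<open>1 < q\<close> by (intro powr_mono2) auto
    then have "\<bar>f' (e + t * (x - e))\<bar> \<le> G t"
      using \<open>1 < q\<close> by (simp add: powr_powr)
    then show ?thesis by (simp add: abs_mult mult_left_mono)
  qed
  have "((\<lambda>t. t powr \<mu> * (\<bar>x - e\<bar> * G t)) has_integral \<bar>x - e\<bar> * C) {0..1}"
    using has_integral_mult_right[OF C, of "\<bar>x - e\<bar>"] by (simp add: mult.left_commute)
  from weighted_derivative_bound[OF \<open>0 < \<mu>\<close> h bound this]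
  obtain I where I: "((\<lambda>t. t powr (\<mu> - 1) * f (e + t * (x - e))) has_integral I) {0..1}"
    and le: "\<bar>f (e + 1 * (x - e)) - \<mu> * I\<bar> \<le> \<bar>x - e\<bar> * C"
    by blast
  have f_seg: "0 \<le> f y" if "y \<in> closed_segment e x" for y
    using that \<open>0 \<le> e\<close> \<open>0 \<le> x\<close> f_nonneg by (auto simp: closed_segment_eq_real_ivl split: if_splits)
  have int: "set_lebesgue_integral lebesgue (closed_segment e x) (\<lambda>y. \<bar>y - e\<bar> powr (\<mu> - 1) * f y)
      = \<bar>x - e\<bar> powr \<mu> * I"
    by (rule set_lebesgue_integral_segment[OF False f_seg I])
  have "\<bar>\<bar>x - e\<bar> powr \<mu> * f x - \<mu> * (\<bar>x - e\<bar> powr \<mu> * I)\<bar> = \<bar>\<bar>x - e\<bar> powr \<mu> * (f x - \<mu> * I)\<bar>"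
    by (simp add: algebra_simps)
  also have "\<dots> = \<bar>x - e\<bar> powr \<mu> * \<bar>f x - \<mu> * I\<bar>"
    by (simp add: abs_mult)
  also have "\<dots> \<le> \<bar>x - e\<bar> powr \<mu> * (\<bar>x - e\<bar> * C)"
    using le by (intro mult_left_mono) auto
  also have "\<dots> = C * \<bar>x - e\<bar> powr (\<mu> + 1)"
    using False by (simp add: powr_add)
  also have "\<dots> \<le> ((q - 1) / (\<mu> * (q - p) + q - 1)) powr ((q - 1) / q)
             * K2 \<alpha> m \<mu> p M powr (1 / q) * \<bar>x - e\<bar> powr (\<mu> + 1)"
    using C_le by (intro mult_right_mono) auto
  finally show ?thesis unfolding int .
qed

section \<open>Combining the segments from \<open>a\<close> and from \<open>b\<close>\<close>

theorem theorem2: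
  fixes f f' :: "real \<Rightarrow> real" and a b \<alpha> m \<mu> p q M x :: real
  assumes "\<And>y. 0 \<le> y \<Longrightarrow> 0 < f y"
    and "\<And>y. 0 \<le> y \<Longrightarrow> (f has_real_derivative f' y) (at y within {0..})"
    and "0 \<le> a" and "a < b"
    and "0 < \<alpha>" and "\<alpha> \<le> 1" and "0 < m" and "m \<le> 1"
    and "0 < \<mu>" and "1 < q" and "0 \<le> p" and "p \<le> q"
    and "f' absolutely_integrable_on {a..b}"
    and "log_convex_am \<alpha> m (\<lambda>y. \<bar>f' y\<bar> powr q)"
    and "\<And>y. 0 \<le> y \<Longrightarrow> \<bar>f' y\<bar> powr q \<le> M"
    and "M \<le> 1"
    and "x \<in> {a..b}"
  shows "\<bar>((x - a) powr \<mu> + (b - x) powr \<mu>) / (b - a) * f x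
           - Gamma (\<mu> + 1) / (b - a) * (RL_minus \<mu> f x a + RL_plus \<mu> f x b)\<bar>
         \<le> ((q - 1) / (\<mu> * (q - p) + q - 1)) powr ((q - 1) / q)
             * K2 \<alpha> m \<mu> p M powr (1 / q)
             * (((x - a) powr (\<mu> + 1) + (b - x) powr (\<mu> + 1)) / (b - a))"
proof -
  let ?k = "((q - 1) / (\<mu> * (q - p) + q - 1)) powr ((q - 1) / q) * K2 \<alpha> m \<mu> p M powr (1 / q)"
  let ?Jl = "set_lebesgue_integral lebesgue {a..x} (\<lambda>t. (t - a) powr (\<mu> - 1) * f t)"
  let ?Jr = "set_lebesgue_integral lebesgue {x..b} (\<lambda>t. (b - t) powr (\<mu> - 1) * f t)"
  have ax: "a \<le> x" and xb: "x \<le> b" using \<open>x \<in> {a..b}\<close> by auto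
  have "set_lebesgue_integral lebesgue (closed_segment a x) (\<lambda>y. \<bar>y - a\<bar> powr (\<mu> - 1) * f y) = ?Jl"
    using ax by (auto simp: closed_segment_eq_real_ivl intro!: set_lebesgue_integral_cong)
  with fractional_segment_bound[of f f' a x \<alpha> m \<mu> q p M]
  have l: "\<bar>(x - a) powr \<mu> * f x - \<mu> * ?Jl\<bar> \<le> ?k * (x - a) powr (\<mu> + 1)"
    using assms ax by (simp add: less_imp_le)
  \<comment> \<open>The endpoint \<open>b\<close> lies to the right, so |y - b| becomes
    \<open>b - y\<close> on the segment.\<close>
  have "set_lebesgue_integral lebesgue (closed_segment b x) (\<lambda>y. \<bar>y - b\<bar> powr (\<mu> - 1) * f y) = ?Jr"
    using xb by (auto simp: closed_segment_eq_real_ivl intro!: set_lebesgue_integral_cong)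
  with fractional_segment_bound[of f f' b x \<alpha> m \<mu> q p M]
  have r: "\<bar>(b - x) powr \<mu> * f x - \<mu> * ?Jr\<bar> \<le> ?k * (b - x) powr (\<mu> + 1)"
    using assms ax xb by (simp add: less_imp_le)
  \<comment> \<open>Away from the poles the functional equation of Gamma cancels the normalization
    \<open>1 / Gamma \<mu>\<close> and leaves the factor \<open>\<mu>\<close> of the segment
    bound.\<close>
  have "\<mu> \<notin> \<int>\<^sub>\<le>\<^sub>0" using \<open>0 < \<mu>\<close> by (auto elim!: nonpos_Ints_cases)
  then have "Gamma (\<mu> + 1) = \<mu> * Gamma \<mu>" "Gamma \<mu> \<noteq> 0"
    by (simp_all add: Gamma_plus1 Gamma_eq_zero_iff)
  then have "Gamma (\<mu> + 1) * (RL_minus \<mu> f x a + RL_plus \<mu> f x b) = \<mu> * ?Jl + \<mu> * ?Jr"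
    by (simp add: RL_minus_def RL_plus_def distrib_left)
  then have "Gamma (\<mu> + 1) / (b - a) * (RL_minus \<mu> f x a + RL_plus \<mu> f x b)
      = (\<mu> * ?Jl + \<mu> * ?Jr) / (b - a)"
    by (metis times_divide_eq_left)
  then have "((x - a) powr \<mu> + (b - x) powr \<mu>) / (b - a) * f x
           - Gamma (\<mu> + 1) / (b - a) * (RL_minus \<mu> f x a + RL_plus \<mu> f x b)
      = (((x - a) powr \<mu> * f x - \<mu> * ?Jl) + ((b - x) powr \<mu> * f x - \<mu> * ?Jr)) / (b - a)"
    by (simp only: times_divide_eq_left diff_divide_distrib[symmetric]) (simp add: algebra_simps)
  also have "\<bar>\<dots>\<bar> \<le> (?k * (x - a) powr (\<mu> + 1) + ?k * (b - x) powr (\<mu> + 1)) / (b - a)"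
    using l r \<open>a < b\<close> by (simp add: abs_divide divide_right_mono)
  also have "\<dots> = ?k * (((x - a) powr (\<mu> + 1) + (b - x) powr (\<mu> + 1)) / (b - a))"
    by (simp add: distrib_left)
  finally show ?thesis .
qed

end
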